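(* Let $S\subseteq\mathbb{Z}^n$ be a bounded set with $\mathbf{0}\in S\subseteq\mathbb{Z}_+^n$. Then $S$ is both M$^\natural$-convex and multimodular if and only if there is an integer-valued function $r(a,b)$, defined for all integers $1\le a\le b\le n$, satisfying (i) $r(a,a)\ge 0$ for all $a$; (ii) $\max\{r(a,b-1),\,r(a+1,b)\}\le r(a,b)$ for all $a<b$; (iii) $r(a,b)\le r(a,b-1)+r(a+1,b)-r(a+1,b-1)$ for all $a<b$, where $r(a+1,b-1):=0$ when $a+1>b-1$; such that $$S=\Big\{x\in\mathbb{Z}_+^n:\ \sum_{i=a}^{b}x_i\le r(a,b)\ \text{ for all } 1\le a\le b\le n\Big\}.$$
   Context: $N=\{1,\dots,n\}$, $e_i$ is the $i$th unit vector, $e_0=\mathbf{0}$, $\mathrm{supp}^+(z)=\{i: z_i>0\}$, $\mathrm{supp}^-(z)=\{i:z_i<0\}$. A nonempty set $S\subseteq\mathbb{Z}^n$ is M$^\natural$-convex if for any $x,y\in S$ and $i\in\mathrm{supp}^+(x-y)$, either $x-e_i\in S$ and $y+e_i\in S$, or there exists $j\in\mathrm{supp}^-(x-y)$ with $x-e_i+e_j\in S$ and $y+e_i-e_j\in S$. For a function $h$ on $\mathbb{Z}^m$, submodular means $h(u)+h(v)\ge h(u\vee v)+h(u\wedge v)$ (componentwise max/min). For $f:\mathbb{Z}^n\to\mathbb{R}\cup\{+\infty\}$ with nonempty effective domain, $f$ is multimodular if $\tilde f(x_0,x)=f(x_1-x_0,x_2-x_1,\dots,x_n-x_{n-1})$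 is submodular on $\mathbb{Z}^{n+1}$. A nonempty set $S$ is multimodular if its indicator function ($0$ on $S$, $+\infty$ elsewhere) is multimodular. *)

theory Defs
  imports Main "HOL-Library.Extended_Real" "HOL-Library.Function_Algebras"
begin

text \<open>
  Integer vectors indexed by a finite set \<open>I\<close> of naturals are functions vanishing outside \<open>I\<close>, so that
  \<open>\<int>\<^sup>n\<close> is \<open>int_vecs {1..n}\<close> and \<open>\<int>\<^sup>n\<^sup>+\<^sup>1\<close>, with coordinates \<open>x\<^sub>0, \<dots>, x\<^sub>n\<close>, is \<open>int_vecs {0..n}\<close>.
  Sums, differences, the order, \<open>sup\<close> and \<open>inf\<close> of vectors are the pointwise ones, under which
  \<open>int_vecs I\<close> is closed.
\<close>

definition int_vecs :: "nat set \<Rightarrow> (nat \<Rightarrow> int) set" where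
  "int_vecs I = {x. \<forall>i. i \<notin> I \<longrightarrow> x i = 0}"

definition unit_vec :: "nat \<Rightarrow> nat \<Rightarrow> int" where
  "unit_vec i = (\<lambda>k. if k = i then 1 else 0)"

definition supp_pos :: "(nat \<Rightarrow> int) \<Rightarrow> nat set" where
  "supp_pos z = {i. z i > 0}"

definition supp_neg :: "(nat \<Rightarrow> int) \<Rightarrow> nat set" where
  "supp_neg z = {i. z i < 0}"

definition bounded_vecs :: "nat \<Rightarrow> (nat \<Rightarrow> int) set \<Rightarrow> bool" where
  "bounded_vecs n S \<longleftrightarrow> (\<exists>M. \<forall>x\<in>S. \<forall>i\<in>{1..n}. \<bar>x i\<bar> \<le> M)"

definition M_natural_convex :: "nat \<Rightarrow> (nat \<Rightarrow> int) set \<Rightarrow> bool" where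
  "M_natural_convex n S \<longleftrightarrow>
     S \<noteq> {} \<and> S \<subseteq> int_vecs {1..n} \<and>
     (\<forall>x\<in>S. \<forall>y\<in>S. \<forall>i\<in>supp_pos (x - y).
        (x - unit_vec i \<in> S \<and> y + unit_vec i \<in> S) \<or>
        (\<exists>j\<in>supp_neg (x - y).
           x - unit_vec i + unit_vec j \<in> S \<and> y + unit_vec i - unit_vec j \<in> S))"

definition submodular_on :: "nat set \<Rightarrow> ((nat \<Rightarrow> int) \<Rightarrow> ereal) \<Rightarrow> bool" where
  "submodular_on I h \<longleftrightarrow>
     (\<forall>u\<in>int_vecs I. \<forall>v\<in>int_vecs I. h u + h v \<ge> h (sup u v) + h (inf u v))"

definition diff_vec :: "nat \<Rightarrow> (nat \<Rightarrow> int) \<Rightarrow> nat \<Rightarrow> int" where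
  "diff_vec n x = (\<lambda>i. if i \<in> {1..n} then x i - x (i - 1) else 0)"

text \<open>The first conjunct expresses that \<open>f\<close> takes values in \<open>\<real> \<union> {+\<infinity>}\<close>, the second that its effective
  domain is nonempty.\<close>

definition multimodular :: "nat \<Rightarrow> ((nat \<Rightarrow> int) \<Rightarrow> ereal) \<Rightarrow> bool" where
  "multimodular n f \<longleftrightarrow>
     (\<forall>x\<in>int_vecs {1..n}. f x \<noteq> -\<infinity>) \<and>
     (\<exists>x\<in>int_vecs {1..n}. f x \<noteq> \<infinity>) \<and>
     submodular_on {0..n} (\<lambda>x. f (diff_vec n x))"

definition indicator_fun :: "(nat \<Rightarrow> int) set \<Rightarrow> (nat \<Rightarrow> int) \<Rightarrow> ereal" where
  "indicator_fun S = (\<lambda>x. if x \<in> S then 0 else \<infinity>)"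

definition multimodular_set :: "nat \<Rightarrow> (nat \<Rightarrow> int) set \<Rightarrow> bool" where
  "multimodular_set n S \<longleftrightarrow>
     S \<noteq> {} \<and> S \<subseteq> int_vecs {1..n} \<and> multimodular n (indicator_fun S)"

end

theory Submission
  imports Defs
begin

text \<open>
  In terms of the prefix sums \<open>X k = x 1 + \<dots> + x k\<close> the inequalities read \<open>X q - X p \<le> R p q\<close> for
  \<open>p \<le> q\<close>, where \<open>R p q = r (p + 1) q\<close> and \<open>R p p = 0\<close>; condition (iii) says that \<open>R\<close> is a Monge array.
  Difference constraints are preserved by \<open>sup\<close> and \<open>inf\<close>, whence multimodularity. For the exchange
  property, tight intervals that meet are closed under union and intersection. If no exchange existed, the
  minimal tight interval of \<open>y\<close> around \<open>i\<close> could be enlarged on both sides by intervals that are tight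
  for \<open>x\<close>, until a constraint on \<open>x\<close> is violated.

  Conversely, \<open>r a b\<close> is the maximum of \<open>x a + \<dots> + x b\<close> over \<open>S\<close>. The exchange property yields one point
  of \<open>S\<close> that maximises the sums over two nested sets at once, which is (iii). Closure of the set of
  prefix sums under \<open>sup\<close>, \<open>inf\<close> and translation shows that this set is cut out by difference constraints.
\<close>

section \<open>Difference constraints given by a Monge array\<close>

text \<open>With \<open>R p q\<close> read as the value of the half-open interval from
  \<open>p\<close> to \<open>q\<close>, this is submodularity for two intervals that overlap or
  touch: \<open>R p q'\<close> belongs to their union, \<open>R p' q\<close> to their
  intersection.\<close>

locale monge_array =
  fixes n :: nat and R :: "nat \<Rightarrow> nat \<Rightarrow> int"
  assumes monge: "\<lbrakk>p \<le> p'; p' \<le> q; q \<le> q'; q' \<le> n\<rbrakk> \<Longrightarrow> R p q' + R p' q \<le> R p q + R p' q'"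
begin

definition feasible :: "(nat \<Rightarrow> int) \<Rightarrow> bool" where
  "feasible X \<longleftrightarrow> (\<forall>p q. p \<le> q \<and> q \<le> n \<longrightarrow> X q - X p \<le> R p q)"

definition tight :: "(nat \<Rightarrow> int) \<Rightarrow> nat \<Rightarrow> nat \<Rightarrow> bool" where
  "tight X p q \<longleftrightarrow> p \<le> q \<and> q \<le> n \<and> X q - X p = R p q"

lemma feasibleD: "\<lbrakk>feasible X; p \<le> q; q \<le> n\<rbrakk> \<Longrightarrow> X q - X p \<le> R p q"
  by (auto simp: feasible_def)

text \<open>The differences of \<open>X\<close> over union and intersection add up to those over the
  two given intervals, so the Monge inequality leaves no slack in either bound.\<close>

lemma tight_cross:
  assumes "feasible X" "tight X p q" "tight X p' q'" "p \<le> p'" "p' \<le> q" "q \<le> q'"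
  shows "tight X p q'" "tight X p' q"
  using assms monge[of p p' q q'] feasibleD[of X p q'] feasibleD[of X p' q]
  by (auto simp: tight_def)

text \<open>Meant for an interval \<open>a..b\<close> that is tight for \<open>Y\<close>: it is
  widened to the left at a cost in \<open>R\<close> covered by the surplus of \<open>X\<close> over
  \<open>Y\<close>. Walking left from \<open>m\<close>, one jumps over intervals tight for
  \<open>X\<close>, where \<open>Y\<close> cannot gain more than \<open>X\<close>, and otherwise
  takes unit steps, where \<open>cover\<close> excludes a deficit of \<open>X\<close>.\<close>

lemma left_extension:
  assumes X: "feasible X" and Y: "feasible Y" and "a \<le> m" "m \<le> b" "b \<le> n"
    and cover: "\<And>j. \<lbrakk>a \<le> j; j < m; X (Suc j) - X j < Y (Suc j) - Y j\<rbrakk> \<Longrightarrow>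
                  \<exists>p q. p \<le> j \<and> j < q \<and> q \<le> m \<and> tight X p q"
  shows "\<exists>a'\<le>a. R a' b - R a b \<le> X m - X a' - (Y m - Y a)"
proof -
  \<comment> \<open>Induction on the cut points that no tight interval left of \<open>m\<close> straddles.\<close>
  define good where "good c \<longleftrightarrow> (\<forall>p q. tight X p q \<longrightarrow> p < c \<longrightarrow> c < q \<longrightarrow> m < q)" for c
  have "\<exists>a'\<le>a. R a' b - R a b \<le> X c - X a' - (Y c - Y a)" if "a \<le> c" "c \<le> m" "good c" for c
    using that
  proof (induction c rule: less_induct)
    case (less c)
    consider "c = a" | "a < c" "\<exists>p<c. tight X p c" | "a < c" "\<not> (\<exists>p<c. tight X p c)"
      using less.prems by (auto simp: le_less)
    then show ?case
    proof cases
      case 1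
      then show ?thesis by auto
    next
      case 2
      \<comment> \<open>The leftmost start makes \<open>p\<close> a good cut again: an interval
        straddling \<open>p\<close> would merge with \<open>p..c\<close> into a tight interval that
        ends at \<open>c\<close> and starts earlier.\<close>
      define p where "p = (LEAST p. p < c \<and> tight X p c)"
      have p: "p < c" "tight X p c"
        using LeastI_ex[OF 2(2)] by (auto simp: p_def)
      have p_least: "p \<le> p'" if "p' < c" "tight X p' c" for p'
        using that by (auto simp: p_def intro: Least_le)
      show ?thesis
      proof (cases "a \<le> p")
        case True
        have "good p"
          unfolding good_def
        proof (intro allI impI, rule ccontr)
          fix p' q' assume *: "tight X p' q'" "p' < p" "p < q'" "\<not> m < q'"
          then have "q' \<le> c"
            using less.prems(3) p(1) unfolding good_def by (meson less_trans not_le)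
          then have "tight X p' c"
            using tight_cross(1)[OF X *(1) p(2)] * by simp
          then show False
            using p_least[of p'] *(2) p(1) by simp
        qed
        then obtain a' where "a' \<le> a" "R a' b - R a b \<le> X p - X a' - (Y p - Y a)"
          using less.IH[OF p(1) True] p(1) less.prems by auto
        moreover have "Y c - Y p \<le> X c - X p"
          using p feasibleD[OF Y, of p c] by (auto simp: tight_def)
        ultimately show ?thesis
          by (intro exI[of _ a']) auto
      next
        case False
        \<comment> \<open>The jump passes \<open>a\<close>, so the walk stops with
          \<open>a' = p\<close>; the Monge inequality for \<open>p..c\<close> and
          \<open>a..b\<close> prices the widened interval.\<close>
        have "R p b + R a c \<le> R p c + R a b"
          using False less.prems assms by (intro monge) auto
        moreover have "Y c - Y a \<le> R a c"
          using less.prems assms by (intro feasibleD) auto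
        ultimately show ?thesis
          using p(2) False by (intro exI[of _ p]) (auto simp: tight_def)
      qed
    next
      case 3
      then obtain j where c: "c = Suc j" "a \<le> j"
        by (cases c) auto
      \<comment> \<open>An interval supplied by \<open>cover\<close> would end at \<open>c\<close>,
        excluded in this case, or straddle \<open>c\<close>, excluded by
        \<open>good c\<close>.\<close>
      have "Y c - Y j \<le> X c - X j"
      proof (rule ccontr)
        assume "\<not> ?thesis"
        then obtain p q where "p \<le> j" "j < q" "q \<le> m" "tight X p q"
          using cover[of j] c less.prems by auto
        then show False
          using 3(2) less.prems(3) c(1) unfolding good_def
          by (metis Suc_lessI less_Suc_eq_le not_less)
      qed
      moreover have "good j"
        unfolding good_def
        using 3(2) less.prems(3) c(1) unfolding good_def
        by (metis Suc_lessI less_SucI)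
      then obtain a' where "a' \<le> a" "R a' b - R a b \<le> X j - X a' - (Y j - Y a)"
        using less.IH[of j] c less.prems by auto
      ultimately show ?thesis
        by (intro exI[of _ a']) auto
    qed
  qed
  then show ?thesis
    using assms by (auto simp: good_def)
qed

end

text \<open>Replacing \<open>k\<close> by \<open>n - k\<close> swaps left and right ends, which
  makes the right extension a mirror image of the left one.\<close>

lemma (in monge_array) monge_array_reflect: "monge_array n (\<lambda>p q. R (n - q) (n - p))"
proof
  fix p p' q q' assume "p \<le> p'" "p' \<le> q" "q \<le> q'" "q' \<le> n"
  then show "R (n - q') (n - p) + R (n - q) (n - p') \<le> R (n - q) (n - p) + R (n - q') (n - p')"
    using monge[of "n - q'" "n - q" "n - p'" "n - p"] by (simp add: add.commute)
qed

context monge_array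
begin

lemma right_extension:
  assumes X: "feasible X" and Y: "feasible Y" and "a \<le> m" "m \<le> b" "b \<le> n"
    and cover: "\<And>j. \<lbrakk>m \<le> j; j < b; X (Suc j) - X j < Y (Suc j) - Y j\<rbrakk> \<Longrightarrow>
                  \<exists>p q. m \<le> p \<and> p \<le> j \<and> j < q \<and> tight X p q"
  shows "\<exists>b'\<ge>b. b' \<le> n \<and> R a b' - R a b \<le> X b' - X m - (Y b - Y m)"
proof -
  interpret rev: monge_array n "\<lambda>p q. R (n - q) (n - p)"
    by (rule monge_array_reflect)
  \<comment> \<open>The sign keeps increments: that of \<open>- Z (n - k)\<close> at
    \<open>j\<close> is that of \<open>Z\<close> at \<open>n - Suc j\<close>.\<close>
  have feas: "rev.feasible (\<lambda>k. - Z (n - k))" if "feasible Z" for Z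
    unfolding rev.feasible_def
  proof (intro allI impI)
    fix p q assume "p \<le> q \<and> q \<le> n"
    then show "- Z (n - q) - - Z (n - p) \<le> R (n - q) (n - p)"
      using feasibleD[OF that, of "n - q" "n - p"] by (simp add: diff_le_mono2)
  qed
  have "\<exists>a'\<le>n - b. R (n - (n - a)) (n - a') - R (n - (n - a)) (n - (n - b))
      \<le> - X (n - (n - m)) - - X (n - a') - (- Y (n - (n - m)) - - Y (n - (n - b)))"
  proof (rule rev.left_extension[OF feas[OF X] feas[OF Y]])
    fix j assume j: "n - b \<le> j" "j < n - m"
      "- X (n - Suc j) - - X (n - j) < - Y (n - Suc j) - - Y (n - j)"
    have eq: "Suc (n - Suc j) = n - j"
      using j by simp
    have "\<exists>p q. m \<le> p \<and> p \<le> n - Suc j \<and> n - Suc j < q \<and> tight X p q"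
      using j assms(3-5) by (intro cover) (unfold eq, auto)
    then obtain p q where pq: "m \<le> p" "p \<le> n - Suc j" "n - Suc j < q" "tight X p q"
      by blast
    then have "rev.tight (\<lambda>k. - X (n - k)) (n - q) (n - p)"
      by (auto simp: tight_def rev.tight_def)
    moreover have "n - q \<le> j" "j < n - p" "n - p \<le> n - m"
      using pq j diff_le_mono2[OF pq(1)] by (auto simp: tight_def)
    ultimately show "\<exists>p q. p \<le> j \<and> j < q \<and> q \<le> n - m \<and> rev.tight (\<lambda>k. - X (n - k)) p q"
      by blast
  qed (use assms in auto)
  then obtain a' where "a' \<le> n - b" "R a (n - a') - R a b \<le> X (n - a') - X m - (Y b - Y m)"
    using assms(3-5) by auto
  then show ?thesis
    using assms(3-5) by (intro exI[of _ "n - a'"]) auto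
qed

text \<open>The increment at \<open>m\<close> is coordinate \<open>Suc m\<close>. The properties of
  \<open>j\<close> are what keeps \<open>X\<close> and \<open>Y\<close> feasible when
  \<open>X\<close> moves a unit from \<open>m\<close> to \<open>j\<close> and \<open>Y\<close> one
  from \<open>j\<close> to \<open>m\<close>: no tight interval receives a unit without giving
  one.\<close>

lemma exchange:
  assumes X: "feasible X" and Y: "feasible Y"
    and less: "Y (Suc m) - Y m < X (Suc m) - X m"
    and ex: "\<exists>p q. tight Y p q \<and> p \<le> m \<and> m < q"
  obtains j where "j < n" "X (Suc j) - X j < Y (Suc j) - Y j"
    "\<And>p q. \<lbrakk>tight Y p q; p \<le> m; m < q\<rbrakk> \<Longrightarrow> p \<le> j \<and> j < q"
    "\<And>p q. \<lbrakk>tight X p q; p \<le> j; j < q\<rbrakk> \<Longrightarrow> p \<le> m \<and> m < q"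
proof -
  obtain a b where ab: "tight Y a b" "a \<le> m" "m < b"
    and min: "\<And>p q. \<lbrakk>tight Y p q; p \<le> m; m < q\<rbrakk> \<Longrightarrow> b - a \<le> q - p"
  proof -
    obtain z where "tight Y (fst z) (snd z) \<and> fst z \<le> m \<and> m < snd z"
      "\<And>z'. tight Y (fst z') (snd z') \<and> fst z' \<le> m \<and> m < snd z' \<Longrightarrow> snd z - fst z \<le> snd z' - fst z'"
      using ex_has_least_nat[of "\<lambda>z. tight Y (fst z) (snd z) \<and> fst z \<le> m \<and> m < snd z" _
          "\<lambda>z. snd z - fst z"] ex by fastforce
    then show ?thesis
      using that[of "fst z" "snd z"] by fastforce
  qed
  \<comment> \<open>Crossing tight intervals have a tight intersection, so a shortest one around
    \<open>m\<close> lies inside all others.\<close>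
  have inside: "p \<le> a \<and> b \<le> q" if pq: "tight Y p q" "p \<le> m" "m < q" for p q
  proof (rule ccontr)
    assume *: "\<not> ?thesis"
    show False
    proof (cases "p \<le> a")
      case True
      then have "tight Y a q" using tight_cross(2)[OF Y pq(1) ab(1)] * pq ab by simp
      then show False using min[of a q] * pq ab True by auto
    next
      case False
      show False
      proof (cases "q \<le> b")
        case True
        then show False using min[OF pq] False pq ab by auto
      next
        case False': False
        then have "tight Y p b" using tight_cross(2)[OF Y ab(1) pq(1)] False pq ab by simp
        then show False using min[of p b] False pq ab by auto
      qed
    qed
  qed
  have "\<exists>j. a \<le> j \<and> j < b \<and> X (Suc j) - X j < Y (Suc j) - Y j \<and>
          (\<forall>p q. tight X p q \<longrightarrow> p \<le> j \<longrightarrow> j < q \<longrightarrow> p \<le> m \<and> m < q)"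
  proof (rule ccontr)
    assume "\<not> ?thesis"
    then have cover: "\<exists>p q. tight X p q \<and> p \<le> j \<and> j < q \<and> (q \<le> m \<or> Suc m \<le> p)"
      if "a \<le> j" "j < b" "X (Suc j) - X j < Y (Suc j) - Y j" for j
      using that by (metis not_less not_less_eq_eq)
    have "\<exists>a'\<le>a. R a' b - R a b \<le> X m - X a' - (Y m - Y a)"
    proof (rule left_extension[OF X Y])
      fix j assume j: "a \<le> j" "j < m" "X (Suc j) - X j < Y (Suc j) - Y j"
      then show "\<exists>p q. p \<le> j \<and> j < q \<and> q \<le> m \<and> tight X p q"
        using cover[of j] ab by fastforce
    qed (use ab in \<open>auto simp: tight_def\<close>)
    then obtain a' where a': "a' \<le> a" "R a' b - R a b \<le> X m - X a' - (Y m - Y a)"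
      by blast
    \<comment> \<open>Starting from the widened \<open>a'\<close> and from \<open>Suc m\<close>
      leaves only the increment at \<open>m\<close> out of the sum of both estimates.\<close>
    have "\<exists>b'\<ge>b. b' \<le> n \<and> R a' b' - R a' b \<le> X b' - X (Suc m) - (Y b - Y (Suc m))"
    proof (rule right_extension[OF X Y])
      fix j assume j: "Suc m \<le> j" "j < b" "X (Suc j) - X j < Y (Suc j) - Y j"
      then show "\<exists>p q. Suc m \<le> p \<and> p \<le> j \<and> j < q \<and> tight X p q"
        using cover[of j] ab by fastforce
    qed (use ab a' in \<open>auto simp: tight_def\<close>)
    then obtain b' where b': "b \<le> b'" "b' \<le> n"
        "R a' b' - R a' b \<le> X b' - X (Suc m) - (Y b - Y (Suc m))"
      by blast
    \<comment> \<open>As \<open>R a b = Y b - Y a\<close>, adding the estimates gives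
      \<open>R a' b' < X b' - X a'\<close>.\<close>
    show False
      using a' b' less ab feasibleD[OF X, of a' b'] by (auto simp: tight_def)
  qed
  then obtain j where j: "a \<le> j" "j < b" "X (Suc j) - X j < Y (Suc j) - Y j"
    "\<And>p q. \<lbrakk>tight X p q; p \<le> j; j < q\<rbrakk> \<Longrightarrow> p \<le> m \<and> m < q"
    by blast
  show ?thesis
  proof
    show "j < n" using j(2) ab by (auto simp: tight_def)
    show "p \<le> j \<and> j < q" if "tight Y p q" "p \<le> m" "m < q" for p q
      using inside[OF that] j(1,2) by simp
  qed (use j in auto)
qed

end

text \<open>The general inequality is the sum of the local ones over the unit cells of the rectangle
  \<open>p..p'\<close> by \<open>q..q'\<close>; \<open>move\<close> sums one strip.\<close>

lemma monge_arrayI_local: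
  assumes loc: "\<And>p q. \<lbrakk>p < q; q < n\<rbrakk> \<Longrightarrow> R p (Suc q) + R (Suc p) q \<le> R p q + R (Suc p) (Suc q)"
  shows "monge_array n R"
proof
  have move: "R p q' + R (Suc p) q \<le> R p q + R (Suc p) q'" if "p < q" "q \<le> q'" "q' \<le> n" for p q q'
    using that(2,3)
  proof (induction q' rule: dec_induct)
    case (step k)
    then show ?case using loc[of p k] that(1) by simp
  qed simp
  fix p p' q q' assume "p \<le> p'" "p' \<le> q" "q \<le> q'" "q' \<le> n"
  then show "R p q' + R p' q \<le> R p q + R p' q'"
  proof (induction p' rule: dec_induct)
    case (step k)
    then show ?case using step.IH move[of k q q'] by simp
  qed simp
qed

section \<open>Prefix sums and membership in interval polytopes\<close>

definition prefix_sum :: "(nat \<Rightarrow> int) \<Rightarrow> nat \<Rightarrow> int" where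
  "prefix_sum x k = (\<Sum>i=1..k. x i)"

lemma prefix_sum_Suc: "prefix_sum x (Suc k) = prefix_sum x k + x (Suc k)"
  by (simp add: prefix_sum_def)

lemma prefix_sum_diff:
  assumes "p \<le> q"
  shows "prefix_sum x q - prefix_sum x p = (\<Sum>i=Suc p..q. x i)"
  using assms by (induction q rule: dec_induct) (auto simp: prefix_sum_Suc)

lemma sum_unit_vec: "finite A \<Longrightarrow> (\<Sum>i\<in>A. unit_vec j i) = (if j \<in> A then 1 else 0)"
  by (simp add: unit_vec_def)

lemma prefix_sum_unit_vec: "prefix_sum (unit_vec (Suc j)) k = (if j < k then 1 else 0)"
  by (simp add: prefix_sum_def sum_unit_vec less_eq_Suc_le)

lemma prefix_sum_plus: "prefix_sum (x + y) k = prefix_sum x k + prefix_sum y k"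
  by (simp add: prefix_sum_def sum.distrib)

lemma prefix_sum_minus: "prefix_sum (x - y) k = prefix_sum x k - prefix_sum y k"
  by (simp add: prefix_sum_def sum_subtractf)

definition interval_polytope :: "nat \<Rightarrow> (nat \<Rightarrow> nat \<Rightarrow> int) \<Rightarrow> (nat \<Rightarrow> int) set" where
  "interval_polytope n r = {x \<in> int_vecs {1..n}. (\<forall>i\<in>{1..n}. 0 \<le> x i) \<and>
     (\<forall>a b. 1 \<le> a \<and> a \<le> b \<and> b \<le> n \<longrightarrow> (\<Sum>i=a..b. x i) \<le> r a b)}"

text \<open>The interval \<open>a..b\<close> is coded by the cuts \<open>a - 1\<close> and
  \<open>b\<close>. The value 0 on the diagonal matches the convention for empty intervals in
  (iii).\<close>

definition cut_bound :: "(nat \<Rightarrow> nat \<Rightarrow> int) \<Rightarrow> nat \<Rightarrow> nat \<Rightarrow> int" where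
  "cut_bound r p q = (if p < q then r (Suc p) q else 0)"

lemma mem_interval_polytope_iff:
  assumes "monge_array n (cut_bound r)"
  shows "x \<in> interval_polytope n r \<longleftrightarrow> x \<in> int_vecs {1..n} \<and> (\<forall>i\<in>{1..n}. 0 \<le> x i) \<and>
    monge_array.feasible n (cut_bound r) (prefix_sum x)"
proof -
  have "(\<forall>a b. 1 \<le> a \<and> a \<le> b \<and> b \<le> n \<longrightarrow> (\<Sum>i=a..b. x i) \<le> r a b) \<longleftrightarrow>
        (\<forall>p q. p < q \<and> q \<le> n \<longrightarrow> (\<Sum>i=Suc p..q. x i) \<le> r (Suc p) q)"
    by (metis Suc_le_D Suc_le_eq One_nat_def Suc_le_mono le0)
  then show ?thesis
    by (auto simp: interval_polytope_def monge_array.feasible_def[OF assms] prefix_sum_diff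
        cut_bound_def le_less)
qed

text \<open>Lowering a positive coordinate never leaves the polytope, so only
  \<open>y + unit_vec i\<close> can fail. Then some interval around \<open>i\<close> is tight for
  \<open>y\<close>, and \<open>exchange\<close> supplies \<open>j\<close>.\<close>

lemma M_natural_convex_interval_polytope:
  assumes "monge_array n (cut_bound r)" and nonempty: "interval_polytope n r \<noteq> {}"
  shows "M_natural_convex n (interval_polytope n r)"
proof -
  interpret monge_array n "cut_bound r" by fact
  define S where "S = interval_polytope n r"
  note mem = mem_interval_polytope_iff[OF assms(1), folded S_def]
  have exch: "(x - unit_vec i \<in> S \<and> y + unit_vec i \<in> S) \<or>
        (\<exists>j\<in>supp_neg (x - y). x - unit_vec i + unit_vec j \<in> S \<and> y + unit_vec i - unit_vec j \<in> S)"
    if xy: "x \<in> S" "y \<in> S" and "i \<in> supp_pos (x - y)" for x y i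
  proof -
    let ?X = "prefix_sum x" and ?Y = "prefix_sum y"
    have X: "feasible ?X" and Y: "feasible ?Y"
      using xy mem by auto
    have i: "y i < x i"
      using that(3) by (simp add: supp_pos_def)
    have "i \<in> {1..n}"
    proof (rule ccontr)
      assume "i \<notin> {1..n}"
      then have "x i = 0" "y i = 0" using xy by (auto simp: mem int_vecs_def)
      with i show False by simp
    qed
    then obtain m where m: "i = Suc m" "m < n"
      by (cases i) auto
    have vecs: "x - unit_vec i \<in> int_vecs {1..n}" "y + unit_vec i \<in> int_vecs {1..n}"
      using xy \<open>i \<in> {1..n}\<close> by (auto simp: mem int_vecs_def unit_vec_def)
    have y_nonneg: "0 \<le> y k" for k
      using xy by (cases "k \<in> {1..n}") (auto simp: mem int_vecs_def)
    have x_nonneg: "0 \<le> x k" for k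
      using xy by (cases "k \<in> {1..n}") (auto simp: mem int_vecs_def)
    have xi: "1 \<le> x i"
      using i y_nonneg[of i] by simp
    have "feasible (prefix_sum (x - unit_vec i))"
      unfolding feasible_def
    proof (intro allI impI)
      fix p q assume "p \<le> q \<and> q \<le> n"
      then show "prefix_sum (x - unit_vec i) q - prefix_sum (x - unit_vec i) p \<le> cut_bound r p q"
        using feasibleD[OF X, of p q]
        by (auto simp: prefix_sum_minus prefix_sum_unit_vec m split: if_splits)
    qed
    then have "x - unit_vec i \<in> S"
      using vecs xi x_nonneg by (auto simp: mem unit_vec_def)
    show ?thesis
    proof (cases "y + unit_vec i \<in> S")
      case True
      then show ?thesis using \<open>x - unit_vec i \<in> S\<close> by blast
    next
      case False
      then have "\<not> feasible (prefix_sum (y + unit_vec i))"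
        using vecs y_nonneg by (auto simp: mem unit_vec_def)
      then obtain p q where pq: "p \<le> q" "q \<le> n"
        "prefix_sum (y + unit_vec i) q - prefix_sum (y + unit_vec i) p > cut_bound r p q"
        by (auto simp: feasible_def not_le)
      then have "tight ?Y p q \<and> p \<le> m \<and> m < q"
        using feasibleD[OF Y, of p q]
        by (auto simp: tight_def prefix_sum_plus prefix_sum_unit_vec m split: if_splits)
      then have ex: "\<exists>p q. tight ?Y p q \<and> p \<le> m \<and> m < q" by blast
      have "?Y (Suc m) - ?Y m < ?X (Suc m) - ?X m"
        using i m by (simp add: prefix_sum_Suc)
      then obtain j where j: "j < n" "?X (Suc j) - ?X j < ?Y (Suc j) - ?Y j"
        "\<And>p q. \<lbrakk>tight ?Y p q; p \<le> m; m < q\<rbrakk> \<Longrightarrow> p \<le> j \<and> j < q"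
        "\<And>p q. \<lbrakk>tight ?X p q; p \<le> j; j < q\<rbrakk> \<Longrightarrow> p \<le> m \<and> m < q"
        using exchange[OF X Y _ ex] by blast
      have xj: "x (Suc j) < y (Suc j)"
        using j(2) by (simp add: prefix_sum_Suc)
      \<comment> \<open>A sum grows only if its interval contains \<open>Suc j\<close> but not
        \<open>i\<close>; such an interval is not tight, hence by integrality has slack at least
        1.\<close>
      have "feasible (prefix_sum (x - unit_vec i + unit_vec (Suc j)))"
        unfolding feasible_def
      proof (intro allI impI)
        fix p q assume "p \<le> q \<and> q \<le> n"
        moreover from this have "tight ?X p q \<or> ?X q - ?X p < cut_bound r p q"
          using feasibleD[OF X, of p q] by (auto simp: tight_def)
        ultimately show "prefix_sum (x - unit_vec i + unit_vec (Suc j)) q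
            - prefix_sum (x - unit_vec i + unit_vec (Suc j)) p \<le> cut_bound r p q"
          using j(4)[of p q] feasibleD[OF X, of p q]
          by (auto simp: prefix_sum_plus prefix_sum_minus prefix_sum_unit_vec m
              split: if_splits)
      qed
      then have "x - unit_vec i + unit_vec (Suc j) \<in> S"
        using vecs j(1) x_nonneg xi by (auto simp: mem int_vecs_def unit_vec_def)
      moreover have "feasible (prefix_sum (y + unit_vec i - unit_vec (Suc j)))"
        unfolding feasible_def
      proof (intro allI impI)
        fix p q assume "p \<le> q \<and> q \<le> n"
        moreover from this have "tight ?Y p q \<or> ?Y q - ?Y p < cut_bound r p q"
          using feasibleD[OF Y, of p q] by (auto simp: tight_def)
        ultimately show "prefix_sum (y + unit_vec i - unit_vec (Suc j)) q
            - prefix_sum (y + unit_vec i - unit_vec (Suc j)) p \<le> cut_bound r p q"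
          using j(3)[of p q] feasibleD[OF Y, of p q]
          by (auto simp: prefix_sum_plus prefix_sum_minus prefix_sum_unit_vec m
              split: if_splits)
      qed
      then have "y + unit_vec i - unit_vec (Suc j) \<in> S"
        using vecs j(1) y_nonneg xj x_nonneg[of "Suc j"] by (auto simp: mem int_vecs_def unit_vec_def)
      moreover have "Suc j \<in> supp_neg (x - y)"
        using xj by (simp add: supp_neg_def)
      ultimately show ?thesis by blast
    qed
  qed
  show ?thesis
    using exch nonempty mem unfolding M_natural_convex_def S_def[symmetric] by auto
qed

section \<open>Multimodular sets\<close>

text \<open>For values 0 and \<infinity>, submodularity is closure of the preimage under
  \<open>diff_vec\<close> under \<open>sup\<close> and \<open>inf\<close>.\<close>

lemma multimodular_set_iff:
  "multimodular_set n S \<longleftrightarrow> S \<noteq> {} \<and> S \<subseteq> int_vecs {1..n} \<and>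
    (\<forall>u\<in>int_vecs {0..n}. \<forall>v\<in>int_vecs {0..n}. diff_vec n u \<in> S \<longrightarrow> diff_vec n v \<in> S \<longrightarrow>
       diff_vec n (sup u v) \<in> S \<and> diff_vec n (inf u v) \<in> S)"
  by (auto simp: multimodular_set_def multimodular_def submodular_on_def indicator_fun_def)

lemma sum_diff_vec:
  assumes "1 \<le> a" "a \<le> b" "b \<le> n"
  shows "(\<Sum>i=a..b. diff_vec n u i) = u b - u (a - 1)"
  using assms(2,3)
proof (induction b rule: dec_induct)
  case base
  then show ?case using assms(1) by (simp add: diff_vec_def)
qed (simp add: diff_vec_def)

text \<open>In terms of \<open>u\<close>, all constraints, including nonnegativity, bound a
  difference of two coordinates.\<close>

lemma multimodular_set_interval_polytope:
  assumes nonempty: "interval_polytope n r \<noteq> {}"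
  shows "multimodular_set n (interval_polytope n r)"
proof -
  have mem: "diff_vec n u \<in> interval_polytope n r \<longleftrightarrow>
      (\<forall>i\<in>{1..n}. u (i - 1) \<le> u i) \<and>
      (\<forall>a b. 1 \<le> a \<and> a \<le> b \<and> b \<le> n \<longrightarrow> u b - u (a - 1) \<le> r a b)" for u
    by (auto simp: interval_polytope_def sum_diff_vec) (auto simp: diff_vec_def int_vecs_def)
  have "diff_vec n (sup u v) \<in> interval_polytope n r \<and> diff_vec n (inf u v) \<in> interval_polytope n r"
    if uv: "diff_vec n u \<in> interval_polytope n r" "diff_vec n v \<in> interval_polytope n r" for u v
  proof -
    have "sup u v b - sup u v (a - 1) \<le> r a b \<and> inf u v b - inf u v (a - 1) \<le> r a b"
      if "1 \<le> a" "a \<le> b" "b \<le> n" for a b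
    proof -
      have "u b - u (a - 1) \<le> r a b" "v b - v (a - 1) \<le> r a b"
        using uv that unfolding mem by blast+
      then show ?thesis by (auto simp: sup_int_def inf_int_def max_def min_def)
    qed
    moreover have "sup u v (i - 1) \<le> sup u v i \<and> inf u v (i - 1) \<le> inf u v i" if "i \<in> {1..n}" for i
    proof -
      have "u (i - 1) \<le> u i" "v (i - 1) \<le> v i"
        using uv that unfolding mem by blast+
      then show ?thesis by (auto simp: sup_int_def inf_int_def max_def min_def)
    qed
    ultimately show ?thesis
      unfolding mem by blast
  qed
  moreover have "interval_polytope n r \<subseteq> int_vecs {1..n}"
    by (auto simp: interval_polytope_def)
  ultimately show ?thesis
    using nonempty by (simp add: multimodular_set_iff)
qed

text \<open>The free constant \<open>c\<close> later allows a preimage to be normalised at any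
  chosen coordinate.\<close>

lemma diff_vec_prefix_sum:
  assumes "x \<in> int_vecs {1..n}"
  shows "diff_vec n (\<lambda>k. if k \<le> n then prefix_sum x k + c else 0) = x"
proof
  fix i
  show "diff_vec n (\<lambda>k. if k \<le> n then prefix_sum x k + c else 0) i = x i"
    using assms by (cases i) (auto simp: diff_vec_def int_vecs_def prefix_sum_Suc)
qed

text \<open>For fixed \<open>p\<close>, the \<open>sup\<close> over all \<open>q\<close> dominates
  \<open>Z\<close> and still agrees with it at \<open>p\<close>; the \<open>inf\<close> of these
  over all \<open>p\<close> is \<open>Z\<close>.\<close>

lemma mem_of_pairwise_approximation:
  fixes T :: "(nat \<Rightarrow> int) set"
  assumes sup: "\<And>u v. \<lbrakk>u \<in> T; v \<in> T\<rbrakk> \<Longrightarrow> sup u v \<in> T"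
    and inf: "\<And>u v. \<lbrakk>u \<in> T; v \<in> T\<rbrakk> \<Longrightarrow> inf u v \<in> T"
    and T: "T \<subseteq> int_vecs {0..n}" and Z: "Z \<in> int_vecs {0..n}"
    and approx: "\<And>p q. \<lbrakk>p \<le> n; q \<le> n\<rbrakk> \<Longrightarrow> \<exists>u\<in>T. u p = Z p \<and> Z q \<le> u q"
  shows "Z \<in> T"
proof -
  have above: "\<exists>v\<in>T. v p = Z p \<and> (\<forall>q\<le>m. Z q \<le> v q)" if p: "p \<le> n" and "m \<le> n" for p m
    using that(2)
  proof (induction m)
    case 0
    then show ?case using approx[OF p, of 0] by auto
  next
    case (Suc m)
    then obtain v w where "v \<in> T" "v p = Z p" "\<forall>q\<le>m. Z q \<le> v q"
      "w \<in> T" "w p = Z p" "Z (Suc m) \<le> w (Suc m)"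
      using approx[OF p Suc.prems] by auto
    then show ?case
      by (intro bexI[OF _ sup[of v w]]) (auto simp: le_Suc_eq intro: le_supI1 le_supI2)
  qed
  have "\<exists>w\<in>T. (\<forall>q\<le>n. Z q \<le> w q) \<and> (\<forall>p\<le>m. w p = Z p)" if "m \<le> n" for m
    using that
  proof (induction m)
    case 0
    then show ?case using above[of 0 n] by auto
  next
    case (Suc m)
    then obtain v w where "v \<in> T" "\<forall>q\<le>n. Z q \<le> v q" "\<forall>p\<le>m. v p = Z p"
      "w \<in> T" "w (Suc m) = Z (Suc m)" "\<forall>q\<le>n. Z q \<le> w q"
      using above[OF Suc.prems, of n] by auto
    then show ?case
      using Suc.prems
      by (intro bexI[OF _ inf[of v w]]) (auto simp: le_Suc_eq inf_absorb1 inf_absorb2)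
  qed
  from this[of n] obtain w where "w \<in> T" "\<forall>p\<le>n. w p = Z p"
    by auto
  moreover from this have "w = Z"
    using T Z by (intro ext) (force simp: int_vecs_def)
  ultimately show ?thesis by simp
qed

lemma multimodular_set_eq_interval_polytope:
  assumes multi: "multimodular_set n S" and "0 \<in> S"
    and nonneg: "\<And>x i. \<lbrakk>x \<in> S; i \<in> {1..n}\<rbrakk> \<Longrightarrow> 0 \<le> x i"
    and upper: "\<And>x a b. x \<in> S \<Longrightarrow> (\<Sum>i=a..b. x i) \<le> r a b"
    and attained: "\<And>a b. \<exists>x\<in>S. (\<Sum>i=a..b. x i) = r a b"
  shows "S = interval_polytope n r"
proof
  have S: "S \<subseteq> int_vecs {1..n}"
    using multi by (simp add: multimodular_set_iff)
  then show "S \<subseteq> interval_polytope n r"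
    using nonneg upper by (auto simp: interval_polytope_def)
  show "interval_polytope n r \<subseteq> S"
  proof
    fix z assume z: "z \<in> interval_polytope n r"
    define T where "T = {u \<in> int_vecs {0..n}. diff_vec n u \<in> S}"
    define Z where "Z = (\<lambda>k. if k \<le> n then prefix_sum z k else 0)"
    have "Z \<in> T"
    proof (rule mem_of_pairwise_approximation)
      show "sup u v \<in> T" "inf u v \<in> T" if "u \<in> T" "v \<in> T" for u v
        using that multi by (auto simp: T_def multimodular_set_iff int_vecs_def)
      show "T \<subseteq> int_vecs {0..n}" "Z \<in> int_vecs {0..n}"
        by (auto simp: T_def Z_def int_vecs_def)
      fix p q assume pq: "p \<le> n" "q \<le> n"
      show "\<exists>u\<in>T. u p = Z p \<and> Z q \<le> u q"
      proof (cases "p < q")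
        case True
        obtain x where x: "x \<in> S" "(\<Sum>i=Suc p..q. x i) = r (Suc p) q"
          using attained by blast
        \<comment> \<open>A maximiser for the interval from \<open>Suc p\<close> to
          \<open>q\<close>, translated to agree with \<open>Z\<close> at \<open>p\<close>.\<close>
        let ?u = "\<lambda>k. if k \<le> n then prefix_sum x k + (Z p - prefix_sum x p) else 0"
        have "?u \<in> T"
          using diff_vec_prefix_sum x(1) S by (auto simp: T_def int_vecs_def)
        moreover have "(\<Sum>i=Suc p..q. z i) \<le> r (Suc p) q"
          using z True pq by (auto simp: interval_polytope_def)
        then have "Z q \<le> ?u q"
          using prefix_sum_diff[of p q x] prefix_sum_diff[of p q z] x(2) True pq by (simp add: Z_def)
        ultimately show ?thesis
          using pq by (intro bexI[of _ ?u]) auto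
      next
        case False
        \<comment> \<open>For \<open>q \<le> p\<close> the constant vector suffices, since
          \<open>Z\<close> is nondecreasing.\<close>
        let ?u = "\<lambda>k. if k \<le> n then prefix_sum 0 k + Z p else 0"
        have "?u \<in> T"
          using diff_vec_prefix_sum[of 0] \<open>0 \<in> S\<close> S by (auto simp: T_def int_vecs_def)
        moreover have "0 \<le> (\<Sum>i=Suc q..p. z i)"
          using z pq by (intro sum_nonneg) (auto simp: interval_polytope_def)
        then have "Z q \<le> Z p"
          using prefix_sum_diff[of q p z] False pq by (simp add: Z_def)
        ultimately show ?thesis
          using pq by (intro bexI[of _ ?u]) (auto simp: prefix_sum_def)
      qed
    qed
    moreover have "diff_vec n Z = z"
      using diff_vec_prefix_sum[of z n 0] z
      by (simp add: Z_def interval_polytope_def cong: if_cong)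
    ultimately show "z \<in> S"
      by (simp add: T_def)
  qed
qed

section \<open>Maximisers over nested sets\<close>

lemma ex_maximizer_int:
  fixes f :: "'a \<Rightarrow> int"
  assumes "P a" and bound: "\<And>x. P x \<Longrightarrow> f x \<le> B"
  obtains x where "P x" "\<And>y. P y \<Longrightarrow> f y \<le> f x"
proof -
  obtain x where x: "P x" "\<forall>y. P y \<longrightarrow> nat (B - f x) \<le> nat (B - f y)"
    using ex_has_least_nat[of P a "\<lambda>x. nat (B - f x)"] assms(1) by blast
  have "f y \<le> f x" if "P y" for y
    using x(2) bound[OF that] bound[OF x(1)] that by fastforce
  with x(1) show ?thesis by (rule that)
qed

text \<open>Among maximisers over \<open>C\<close>, \<open>y\<close> has the largest sum over
  \<open>D\<close>; among maximisers over \<open>D\<close>, \<open>x\<close> is nearest to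
  \<open>y\<close> in the l1 distance. If \<open>y\<close> fell short on \<open>D\<close>, an
  exchange would improve \<open>y\<close> or bring \<open>x\<close> nearer.\<close>

lemma M_natural_nested_maximizer:
  assumes M: "M_natural_convex n S" and "C \<subseteq> D" and D: "D \<subseteq> {1..n}"
    and y0: "y0 \<in> S" "\<And>z. z \<in> S \<Longrightarrow> (\<Sum>i\<in>C. z i) \<le> (\<Sum>i\<in>C. y0 i)"
    and x0: "x0 \<in> S" "\<And>z. z \<in> S \<Longrightarrow> (\<Sum>i\<in>D. z i) \<le> (\<Sum>i\<in>D. x0 i)"
  obtains y where "y \<in> S" "(\<Sum>i\<in>C. y i) = (\<Sum>i\<in>C. y0 i)" "(\<Sum>i\<in>D. y i) = (\<Sum>i\<in>D. x0 i)"
proof -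
  have fin: "finite D" "finite C"
    using finite_subset[OF D] finite_subset[OF \<open>C \<subseteq> D\<close>] by simp_all
  obtain y where y: "y \<in> S \<and> (\<Sum>i\<in>C. y i) = (\<Sum>i\<in>C. y0 i)"
    and y_max: "\<And>z. z \<in> S \<and> (\<Sum>i\<in>C. z i) = (\<Sum>i\<in>C. y0 i) \<Longrightarrow> (\<Sum>i\<in>D. z i) \<le> (\<Sum>i\<in>D. y i)"
    by (rule ex_maximizer_int[of "\<lambda>z. z \<in> S \<and> (\<Sum>i\<in>C. z i) = (\<Sum>i\<in>C. y0 i)" y0
          "\<lambda>z. \<Sum>i\<in>D. z i" "\<Sum>i\<in>D. x0 i"]) (use y0 x0 in auto)
  obtain x where x: "x \<in> S \<and> (\<Sum>i\<in>D. x i) = (\<Sum>i\<in>D. x0 i)"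
    and x_closest: "\<And>z. z \<in> S \<and> (\<Sum>i\<in>D. z i) = (\<Sum>i\<in>D. x0 i) \<Longrightarrow>
      - (\<Sum>i=1..n. \<bar>z i - y i\<bar>) \<le> - (\<Sum>i=1..n. \<bar>x i - y i\<bar>)"
    by (rule ex_maximizer_int[of "\<lambda>z. z \<in> S \<and> (\<Sum>i\<in>D. z i) = (\<Sum>i\<in>D. x0 i)" x0
          "\<lambda>z. - (\<Sum>i=1..n. \<bar>z i - y i\<bar>)" 0]) (use x0 in \<open>auto intro: sum_nonneg\<close>)
  have "(\<Sum>i\<in>D. y i) = (\<Sum>i\<in>D. x0 i)"
  proof (rule ccontr)
    assume "\<not> ?thesis"
    then have "\<not> (\<Sum>i\<in>D. x i) \<le> (\<Sum>i\<in>D. y i)"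
      using x0(2)[of y] y x by simp
    then obtain i where i: "i \<in> D" "y i < x i"
      by (meson not_le sum_mono)
    have no_gain: False
      if "z \<in> S" "(\<Sum>k\<in>C. z k) \<ge> (\<Sum>k\<in>C. y k)" "(\<Sum>k\<in>D. z k) > (\<Sum>k\<in>D. y k)" for z
      using y_max[of z] y0(2)[of z] y that by auto
    from i(2) have "i \<in> supp_pos (x - y)"
      by (simp add: supp_pos_def)
    then consider "y + unit_vec i \<in> S"
      | j where "x j < y j" "x - unit_vec i + unit_vec j \<in> S" "y + unit_vec i - unit_vec j \<in> S"
      using M x y unfolding M_natural_convex_def supp_neg_def by fastforce
    then show False
    proof cases
      case 1
      then show False
        by (rule no_gain) (use fin i in \<open>auto simp: sum.distrib sum_unit_vec\<close>)
    next
      case (2 j)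
      show False
      proof (cases "j \<in> D")
        case False
        \<comment> \<open>Since \<open>j\<close> lies outside \<open>D\<close>, it lies outside
          \<open>C\<close>: the sum over \<open>D\<close> gains a unit and the sum over
          \<open>C\<close> loses none.\<close>
        then show False
          using assms(2) fin i
          by (intro no_gain[OF 2(3)]) (auto simp: sum.distrib sum_subtractf sum_unit_vec)
      next
        case True
        let ?x = "x - unit_vec i + unit_vec j"
        have "?x \<in> S \<and> (\<Sum>k\<in>D. ?x k) = (\<Sum>k\<in>D. x0 k)"
          using 2 x fin i True by (simp add: sum.distrib sum_subtractf sum_unit_vec)
        moreover have "(\<Sum>k=1..n. \<bar>?x k - y k\<bar>) < (\<Sum>k=1..n. \<bar>x k - y k\<bar>)"
        proof (rule sum_strict_mono_ex1)
          show "\<forall>k\<in>{1..n}. \<bar>?x k - y k\<bar> \<le> \<bar>x k - y k\<bar>"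
            using i 2(1) by (auto simp: unit_vec_def)
          show "\<exists>k\<in>{1..n}. \<bar>?x k - y k\<bar> < \<bar>x k - y k\<bar>"
            using i 2(1) D by (intro bexI[of _ i]) (auto simp: unit_vec_def)
        qed simp
        ultimately show False
          using x_closest[of ?x] by simp
      qed
    qed
  qed
  with y that show ?thesis by blast
qed

text \<open>One point attains both values on the left, and its coordinate sums are modular in the
  index set.\<close>

lemma M_natural_rank_submodular:
  assumes M: "M_natural_convex n S" and "A \<union> B \<subseteq> {1..n}"
    and upper: "\<And>x E. x \<in> S \<Longrightarrow> E \<subseteq> {1..n} \<Longrightarrow> (\<Sum>i\<in>E. x i) \<le> \<rho> E"
    and attained: "\<And>E. E \<subseteq> {1..n} \<Longrightarrow> \<exists>x\<in>S. (\<Sum>i\<in>E. x i) = \<rho> E"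
  shows "\<rho> (A \<union> B) + \<rho> (A \<inter> B) \<le> \<rho> A + \<rho> B"
proof -
  have sub: "A \<inter> B \<subseteq> {1..n}" "A \<subseteq> {1..n}" "B \<subseteq> {1..n}"
    using assms(2) by auto
  obtain y0 where "y0 \<in> S" "(\<Sum>i\<in>A \<inter> B. y0 i) = \<rho> (A \<inter> B)"
    using attained[OF sub(1)] by blast
  moreover obtain x0 where "x0 \<in> S" "(\<Sum>i\<in>A \<union> B. x0 i) = \<rho> (A \<union> B)"
    using attained[OF assms(2)] by blast
  ultimately obtain y where y: "y \<in> S" "(\<Sum>i\<in>A \<inter> B. y i) = \<rho> (A \<inter> B)" "(\<Sum>i\<in>A \<union> B. y i) = \<rho> (A \<union> B)"
    using M_natural_nested_maximizer[OF M _ assms(2), of "A \<inter> B" y0 x0] upper sub(1) assms(2)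
    by (metis inf_sup_ord(1) le_supI1)
  have "(\<Sum>i\<in>A \<union> B. y i) + (\<Sum>i\<in>A \<inter> B. y i) = (\<Sum>i\<in>A. y i) + (\<Sum>i\<in>B. y i)"
    using sub by (intro sum.union_inter) (auto intro: finite_subset)
  then show ?thesis
    using y upper[OF y(1)] sub by (smt (verit, best))
qed

section \<open>The equivalence, with bounds read off from maxima over \<open>S\<close>\<close>

theorem theorem5p11:
  fixes n :: nat and S :: "(nat \<Rightarrow> int) set"
  assumes "bounded_vecs n S"
    and "0 \<in> S"
    and "S \<subseteq> {x \<in> int_vecs {1..n}. \<forall>i\<in>{1..n}. 0 \<le> x i}"
  shows "M_natural_convex n S \<and> multimodular_set n S \<longleftrightarrow>
    (\<exists>r :: nat \<Rightarrow> nat \<Rightarrow> int.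
       (\<forall>a. 1 \<le> a \<and> a \<le> n \<longrightarrow> 0 \<le> r a a) \<and>
       (\<forall>a b. 1 \<le> a \<and> a < b \<and> b \<le> n \<longrightarrow>
          max (r a (b - 1)) (r (a + 1) b) \<le> r a b) \<and>
       (\<forall>a b. 1 \<le> a \<and> a < b \<and> b \<le> n \<longrightarrow>
          r a b \<le> r a (b - 1) + r (a + 1) b
                   - (if a + 1 > b - 1 then 0 else r (a + 1) (b - 1))) \<and>
       S = {x \<in> int_vecs {1..n}. (\<forall>i\<in>{1..n}. 0 \<le> x i) \<and>
              (\<forall>a b. 1 \<le> a \<and> a \<le> b \<and> b \<le> n \<longrightarrow> (\<Sum>i=a..b. x i) \<le> r a b)})"
    (is "?L \<longleftrightarrow> (\<exists>r. ?i r \<and> ?ii r \<and> ?iii r \<and> S = ?P r)")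
proof
  assume L: ?L
  have outside: "x i = 0" if "x \<in> S" "i \<notin> {1..n}" for x i
    using assms(3) that unfolding int_vecs_def by blast
  have nonneg: "0 \<le> x i" if "x \<in> S" for x i
    using assms(3) that outside[OF that, of i] by (cases "i \<in> {1..n}") auto
  obtain M where M: "\<And>x i. \<lbrakk>x \<in> S; i \<in> {1..n}\<rbrakk> \<Longrightarrow> \<bar>x i\<bar> \<le> M"
    using assms(1) unfolding bounded_vecs_def by blast
  have "\<exists>x\<in>S. \<forall>y\<in>S. (\<Sum>i\<in>E. y i) \<le> (\<Sum>i\<in>E. x i)" for E
  proof -
    have "x i \<le> \<bar>M\<bar>" if "x \<in> S" for x i
      using M[OF that, of i] outside[OF that, of i] by (cases "i \<in> {1..n}") auto
    then have "(\<Sum>i\<in>E. x i) \<le> (\<Sum>i\<in>E. \<bar>M\<bar>)" if "x \<in> S" for x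
      using that by (intro sum_mono)
    then obtain x where "x \<in> S" "\<And>y. y \<in> S \<Longrightarrow> (\<Sum>i\<in>E. y i) \<le> (\<Sum>i\<in>E. x i)"
      using ex_maximizer_int[of "\<lambda>x. x \<in> S" 0 "\<lambda>x. \<Sum>i\<in>E. x i"] assms(2) by blast
    then show ?thesis by blast
  qed
  then obtain best where best: "best E \<in> S" "\<And>y. y \<in> S \<Longrightarrow> (\<Sum>i\<in>E. y i) \<le> (\<Sum>i\<in>E. best E i)"
    for E
    by metis
  \<comment> \<open>The rank function of \<open>S\<close>; \<open>r\<close> is its restriction to
    intervals.\<close>
  define \<rho> where "\<rho> E = (\<Sum>i\<in>E. best E i)" for E
  define r where "r a b = \<rho> {a..b}" for a b
  have upper: "(\<Sum>i\<in>E. x i) \<le> \<rho> E" if "x \<in> S" for x E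
    using best that by (simp add: \<rho>_def)
  have attained: "\<exists>x\<in>S. (\<Sum>i\<in>E. x i) = \<rho> E" for E
    using best(1) by (auto simp: \<rho>_def)
  have mono: "\<rho> E \<le> \<rho> F" if "E \<subseteq> F" "finite F" for E F
  proof -
    have "\<rho> E \<le> (\<Sum>i\<in>F. best E i)"
      unfolding \<rho>_def using that by (intro sum_mono2 nonneg[OF best(1)])
    also have "\<dots> \<le> \<rho> F"
      using upper best(1) by blast
    finally show ?thesis .
  qed
  have "0 \<le> \<rho> E" for E
    using upper[OF assms(2), of E] by simp
  then have "?i r"
    by (simp add: r_def)
  moreover have "?ii r"
    by (auto simp: r_def intro!: mono)
  moreover have "?iii r"
  proof (intro allI impI)
    fix a b assume ab: "1 \<le> a \<and> a < b \<and> b \<le> n"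
    \<comment> \<open>The default 0 in (iii) is the rank of the empty interval, so both cases have
      the form \<open>\<rho> {a + 1..b - 1}\<close>.\<close>
    have "\<rho> {} = 0" by (simp add: \<rho>_def)
    then have inner: "(if a + 1 > b - 1 then 0 else r (a + 1) (b - 1)) = \<rho> {a + 1..b - 1}"
      by (simp add: r_def)
    have "\<rho> ({a..b - 1} \<union> {a + 1..b}) + \<rho> ({a..b - 1} \<inter> {a + 1..b})
        \<le> \<rho> {a..b - 1} + \<rho> {a + 1..b}"
    proof (rule M_natural_rank_submodular)
      show "M_natural_convex n S" using L ..
      show "{a..b - 1} \<union> {a + 1..b} \<subseteq> {1..n}" using ab by auto
    qed (rule upper attained, assumption?)+
    moreover have "{a..b - 1} \<union> {a + 1..b} = {a..b}"
      "{a..b - 1} \<inter> {a + 1..b} = {a + 1..b - 1}"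
      using ab by auto
    ultimately have "\<rho> {a..b} + \<rho> {a + 1..b - 1} \<le> \<rho> {a..b - 1} + \<rho> {a + 1..b}"
      by simp
    then show "r a b \<le> r a (b - 1) + r (a + 1) b
        - (if a + 1 > b - 1 then 0 else r (a + 1) (b - 1))"
      unfolding inner by (simp add: r_def)
  qed
  moreover have "S = interval_polytope n r"
  proof (rule multimodular_set_eq_interval_polytope)
    show "multimodular_set n S" using L ..
    show "\<exists>x\<in>S. (\<Sum>i=a..b. x i) = r a b" for a b
      unfolding r_def by (rule attained)
  qed (use assms(2) nonneg upper in \<open>simp_all add: r_def\<close>)
  then have "S = ?P r"
    by (simp only: interval_polytope_def)
  ultimately show "\<exists>r. ?i r \<and> ?ii r \<and> ?iii r \<and> S = ?P r"
    by (intro exI[of _ r] conjI)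
next
  assume "\<exists>r. ?i r \<and> ?ii r \<and> ?iii r \<and> S = ?P r"
  then obtain r where iii: "?iii r" and S: "S = interval_polytope n r"
    unfolding interval_polytope_def[symmetric] by (elim exE conjE)
  have "monge_array n (cut_bound r)"
  proof (rule monge_arrayI_local)
    fix p q assume "p < q" "q < n"
    \<comment> \<open>Condition (iii) for \<open>a = Suc p\<close>, \<open>b = Suc q\<close>; its
      default case is \<open>q = Suc p\<close>.\<close>
    then show "cut_bound r p (Suc q) + cut_bound r (Suc p) q
        \<le> cut_bound r p q + cut_bound r (Suc p) (Suc q)"
      using iii[rule_format, of "Suc p" "Suc q"] by (auto simp: cut_bound_def split: if_splits)
  qed
  then show ?L
    using M_natural_convex_interval_polytope multimodular_set_interval_polytope S assms(2) by blast
qed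

end
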